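(* For a finite tree $T$ on $n = |V(T)|$ vertices, let $$s_5(T) = {}^{m}M_2(T) - \frac{n+1}{4},$$ where ${}^{m}M_2(T) = \sum_{uv \in E(T)} \frac{1}{d_u d_v}$ is the modified second Zagreb index of $T$. For each positive integer $k$, let $T_1(k)$ be the tree on $5k$ vertices with vertex set $\bigcup_{i=1}^k \{u_i, v_i, w_i, x_i, y_i\}$ and edge set $\left(\bigcup_{i=1}^k \{u_iv_i, v_iw_i, w_ix_i, x_iy_i\}\right) \cup \{w_1w_2, w_2w_3, \dots, w_{k-1}w_k\}$. Then $$\lim_{k \to \infty} s_5(T_1(k)) = \infty.$$
   Context: Graphs are finite, simple and undirected; $V(G)$ and $E(G)$ denote the vertex and edge sets of $G$, an edge $\{u,v\}$ is written $uv$, and $d_v$ denotes the degree of the vertex $v$ (the number of vertices adjacent to $v$). In the definition of $T_1(k)$ the $5k$ named vertices are pairwise distinct. *)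

theory Defs
  imports Complex_Main "Graph_Theory.Graph_Theory"
begin

text \<open>
  A finite simple undirected graph is represented by a symmetric loop-free finite digraph on pairs
  (locale \<open>pair_graph\<close>): the edge \<open>uv\<close> is the pair of opposite arcs \<open>(u,v)\<close> and \<open>(v,u)\<close>.
  Hence the out-degree of a vertex is the number of its neighbours, and sums over edges have to
  range over the unordered edges, not over the arcs.
\<close>

definition uedges :: "'a pair_pre_digraph \<Rightarrow> 'a set set" where
  "uedges G = {{u, v} | u v. (u, v) \<in> parcs G}"

definition degree :: "'a pair_pre_digraph \<Rightarrow> 'a \<Rightarrow> nat" where
  "degree G v = out_degree (with_proj G) v"

text \<open>
  The library predicate \<open>tree\<close> is meant for digraphs: it counts the closed walk \<open>u, v, u\<close> as a
  cycle, so a symmetric digraph with an arc never satisfies it. A cycle of an undirected simple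
  graph has length at least 3.
\<close>

definition undirected_tree :: "'a pair_pre_digraph \<Rightarrow> bool" where
  "undirected_tree G \<longleftrightarrow> pair_graph G \<and> connected (with_proj G) \<and>
     \<not> (\<exists>p. pre_digraph.cycle (with_proj G) p \<and> 3 \<le> length p)"

text \<open>In a loop-free graph the product below has exactly the two factors \<open>d\<^sub>u\<close> and \<open>d\<^sub>v\<close>.\<close>

definition modified_zagreb2 :: "'a pair_pre_digraph \<Rightarrow> real" where
  "modified_zagreb2 G = (\<Sum>e\<in>uedges G. 1 / (\<Prod>v\<in>e. real (degree G v)))"

definition s5 :: "'a pair_pre_digraph \<Rightarrow> real" where
  "s5 T = modified_zagreb2 T - (real (card (pverts T)) + 1) / 4"

datatype vertex = U nat | V nat | W nat | X nat | Y nat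

definition T1_edges :: "nat \<Rightarrow> (vertex \<times> vertex) set" where
  "T1_edges k = (\<Union>i\<in>{1..k}. {(U i, V i), (V i, W i), (W i, X i), (X i, Y i)})
     \<union> {(W i, W (i + 1)) | i. 1 \<le> i \<and> i < k}"

definition T1 :: "nat \<Rightarrow> vertex pair_pre_digraph" where
  "T1 k = \<lparr> pverts = (\<Union>i\<in>{1..k}. {U i, V i, W i, X i, Y i}),
            parcs = T1_edges k \<union> (T1_edges k)\<inverse> \<rparr>"


lemma (in pair_graph) degree_eq_card_neighbours: "degree G v = card {w. (v, w) \<in> parcs G}"
proof -
  have "out_arcs (with_proj G) v = Pair v ` {w. (v, w) \<in> parcs G}"
    by (auto simp: out_arcs_def)
  then show ?thesis
    unfolding degree_def out_degree_def by (simp add: card_image inj_on_def)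
qed

lemma (in pair_graph) prod_degree_edge:
  assumes "(u, v) \<in> parcs G"
  shows "(\<Prod>x\<in>{u, v}. real (degree G x)) = real (degree G u) * real (degree G v)"
  using no_loops'[OF assms] by simp

lemma T1_sel:
  "pverts (T1 k) = (\<Union>i\<in>{1..k}. {U i, V i, W i, X i, Y i})"
  "parcs (T1 k) = T1_edges k \<union> (T1_edges k)\<inverse>"
  by (simp_all add: T1_def)

lemma card_T1: "card (pverts (T1 k)) = 5 * k"
proof -
  have "card (\<Union>i\<in>{1..k}. {U i, V i, W i, X i, Y i}) = (\<Sum>i\<in>{1..k}. card {U i, V i, W i, X i, Y i})"
    by (rule card_UN_disjoint) auto
  then show ?thesis by (simp add: T1_sel)
qed

lemma finite_T1_edges: "finite (T1_edges k)"
proof -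
  have "{(W i, W (i + 1)) | i. 1 \<le> i \<and> i < k} = (\<lambda>i. (W i, W (i + 1))) ` {1..<k}"
    by auto
  then show ?thesis by (simp add: T1_edges_def)
qed

lemma pair_graph_T1: "pair_graph (T1 k)"
proof
  show "symmetric (with_proj (T1 k))"
    by (auto simp: symmetric_def T1_sel sym_def)
qed (auto simp: T1_sel finite_T1_edges, auto simp: T1_edges_def)

fun T1_rank :: "vertex \<Rightarrow> nat" where
  "T1_rank (W i) = i"
| "T1_rank (V i) = i + 1"
| "T1_rank (X i) = i + 1"
| "T1_rank (U i) = i + 2"
| "T1_rank (Y i) = i + 2"

fun T1_parent :: "vertex \<Rightarrow> vertex" where
  "T1_parent (W i) = W (i - 1)"
| "T1_parent (V i) = W i"
| "T1_parent (X i) = W i"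
| "T1_parent (U i) = V i"
| "T1_parent (Y i) = X i"

lemma T1_arc_le_parent:
  assumes "(a, b) \<in> parcs (T1 k)" and "T1_rank b \<le> T1_rank a"
  shows "b = T1_parent a"
  using assms by (auto simp: T1_sel T1_edges_def)

lemma T1_parent_arc:
  assumes "a \<in> pverts (T1 k)" and "a \<noteq> W 1"
  shows "(a, T1_parent a) \<in> parcs (T1 k)" "T1_rank (T1_parent a) < T1_rank a"
proof -
  have "(W i, W (i - 1)) \<in> parcs (T1 k)" if "1 \<le> i" "i \<le> k" "i \<noteq> 1" for i
  proof -
    have "(W (i - 1), W (i - 1 + 1)) \<in> T1_edges k"
      unfolding T1_edges_def using that by (intro UnI2 CollectI exI[of _ "i - 1"]) auto
    with that show ?thesis by (simp add: T1_sel)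
  qed
  note W_arc = this
  from assms(1) obtain i where i: "1 \<le> i" "i \<le> k" "a \<in> {U i, V i, W i, X i, Y i}"
    by (auto simp: T1_sel)
  then have pend: "{(U i, V i), (V i, W i), (W i, X i), (X i, Y i)} \<subseteq> T1_edges k"
    unfolding T1_edges_def by fastforce
  show "(a, T1_parent a) \<in> parcs (T1 k)"
  proof (cases "a = W i")
    case True
    with assms(2) have "i \<noteq> 1" by auto
    from W_arc[OF i(1,2) this] True show ?thesis by simp
  qed (use i(3) pend in \<open>auto simp: T1_sel\<close>)
  from i(1,3) assms(2) show "T1_rank (T1_parent a) < T1_rank a" by auto
qed

lemma T1_reaches_root:
  assumes "a \<in> pverts (T1 k)"
  shows "(a, W 1) \<in> rtrancl_on (pverts (T1 k)) (parcs (T1 k))"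
  using assms
proof (induction "T1_rank a" arbitrary: a rule: less_induct)
  case less
  interpret pair_graph "T1 k" by (rule pair_graph_T1)
  show ?case
  proof (cases "a = W 1")
    case True
    with less.prems show ?thesis by auto
  next
    case False
    note arc = T1_parent_arc[OF less.prems False]
    then have "T1_parent a \<in> pverts (T1 k)" by (auto dest: in_arcsD2)
    with less.hyps arc(2) have "(T1_parent a, W 1) \<in> rtrancl_on (pverts (T1 k)) (parcs (T1 k))"
      by blast
    with arc(1) less.prems show ?thesis by (blast intro: converse_rtrancl_on_into_rtrancl_on)
  qed
qed

lemma connected_T1:
  assumes "1 \<le> k"
  shows "connected (with_proj (T1 k))"
proof -
  interpret pair_graph "T1 k" by (rule pair_graph_T1)
  have *: "reachable (with_proj (T1 k)) a (W 1)" if "a \<in> pverts (T1 k)" for a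
    using T1_reaches_root[OF that] by (simp add: reachable_def)
  have "reachable (with_proj (T1 k)) a b"
    if "a \<in> pverts (T1 k)" "b \<in> pverts (T1 k)" for a b
    using *[OF that(1)] *[OF that(2)] by (meson reachable_trans symmetric_reachable')
  moreover have "W 1 \<in> pverts (T1 k)" using assms by (auto simp: T1_sel)
  ultimately show ?thesis
    unfolding connected_def strongly_connected_def
    using reachable_mk_symmetric_eq[OF sym_arcs] by auto
qed

lemma pcas_nth:
  assumes "pcas u p v" and "Suc i < length p"
  shows "snd (p ! i) = fst (p ! Suc i)"
  using assms
proof (induction u p v arbitrary: i rule: pcas.induct)
  case (2 u e es v)
  then show ?case by (cases i; cases es) auto
qed simp

lemma pcas_ends: "pcas u p v \<Longrightarrow> p \<noteq> [] \<Longrightarrow> fst (hd p) = u \<and> snd (last p) = v"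
proof (induction u p v rule: pcas.induct)
  case (2 u e es v)
  then show ?case by (cases es) auto
qed simp

lemma T1_no_cycle:
  assumes "pre_digraph.cycle (with_proj (T1 k)) p" and len: "3 \<le> length p"
  shows False
proof -
  interpret pair_graph "T1 k" by (rule pair_graph_T1)
  let ?n = "length p"
  from assms obtain u where walk: "awalk u p u" and dist: "distinct (tl (pawalk_verts u p))"
    by (auto simp: cycle_def)
  have ne: "p \<noteq> []" using len by auto
  have arcs: "set p \<subseteq> parcs (T1 k)" and cas: "pcas u p u"
    using walk by (auto simp: awalk_def)
  have "pawalk_verts u p = fst (hd p) # map snd p"
    using awalk_verts_conv'[of u p u] cas ne by simp
  with dist have dist': "distinct (map snd p)" by simp
  have succ: "fst (p ! (Suc i mod ?n)) = snd (p ! i)" if "i < ?n" for i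
  proof (cases "Suc i < ?n")
    case True
    then show ?thesis using pcas_nth[OF cas True] by simp
  next
    case False
    with that have "Suc i = ?n" by simp
    then have "i = ?n - 1" "Suc i mod ?n = 0" by simp_all
    with pcas_ends[OF cas ne] ne show ?thesis
      by (simp add: hd_conv_nth last_conv_nth)
  qed
  \<comment> \<open>Both neighbours on the cycle of a vertex of maximal rank are its parent.\<close>
  have "\<exists>j < ?n. \<forall>i < ?n. T1_rank (snd (p ! i)) \<le> T1_rank (snd (p ! j))"
  proof -
    let ?S = "(\<lambda>i. T1_rank (snd (p ! i))) ` {..<?n}"
    have "finite ?S" "?S \<noteq> {}" using ne by auto
    then have "Max ?S \<in> ?S" by (rule Max_in)
    then obtain j where "j < ?n" "Max ?S = T1_rank (snd (p ! j))" by blast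
    moreover have "T1_rank (snd (p ! i)) \<le> Max ?S" if "i < ?n" for i
      using \<open>finite ?S\<close> that by (intro Max_ge) auto
    ultimately show ?thesis by metis
  qed
  then obtain j where j: "j < ?n"
    and max: "\<And>i. i < ?n \<Longrightarrow> T1_rank (snd (p ! i)) \<le> T1_rank (snd (p ! j))"
    by blast
  define a where "a = (if j = 0 then ?n - 1 else j - 1)"
  define b where "b = Suc j mod ?n"
  have ab: "a < ?n" "b < ?n" "Suc a mod ?n = j" "a \<noteq> b"
    using j len by (auto simp: a_def b_def mod_Suc)
  have "fst (p ! j) = snd (p ! a)" using succ[OF ab(1)] ab(3) by simp
  moreover have "fst (p ! b) = snd (p ! j)" using succ[OF j] by (simp add: b_def)
  moreover have "p ! j \<in> parcs (T1 k)" "p ! b \<in> parcs (T1 k)"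
    using arcs j ab(2) by auto
  ultimately have "(snd (p ! a), snd (p ! j)) \<in> parcs (T1 k)" "(snd (p ! j), snd (p ! b)) \<in> parcs (T1 k)"
    by (metis prod.collapse)+
  then have "snd (p ! a) = T1_parent (snd (p ! j))" "snd (p ! b) = T1_parent (snd (p ! j))"
    using T1_arc_le_parent max ab(1,2) arcs_symmetric by blast+
  then show False
    using dist' ab(1,2,4) nth_eq_iff_index_eq[of "map snd p" a b] by simp
qed

lemma undirected_tree_T1: "1 \<le> k \<Longrightarrow> undirected_tree (T1 k)"
  unfolding undirected_tree_def using pair_graph_T1 connected_T1 T1_no_cycle by blast

end

theory Submission
  imports Defs
begin

text \<open>
  Only \<open>w\<^sub>i\<close> has degree up to 4; \<open>v\<^sub>i, x\<^sub>i\<close> have degree 2 and \<open>u\<^sub>i, y\<^sub>i\<close> are leaves. Hence each block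
  contributes at least \<open>1/2 + 1/8 + 1/8 + 1/2 = 5/4\<close>, which exactly cancels the linear term of
  \<open>(n + 1)/4\<close>, and each of the \<open>k - 1\<close> connecting edges contributes a surplus of at least \<open>1/16\<close>.
\<close>

text \<open>\<open>A\<close> picks one of the two arcs of every edge: if two distinct pairs of
  \<open>A\<close> gave the same edge, each would be the reverse of the other and lie in both
  \<open>A\<close> and its converse. So forgetting the orientation is a bijection from
  \<open>A\<close> onto the edges.\<close>

lemma (in pair_graph) modified_zagreb2_eq_sum_orientation:
  assumes "parcs G = A \<union> A\<inverse>" and "A \<inter> A\<inverse> = {}"
  shows "modified_zagreb2 G = (\<Sum>(u, v)\<in>A. 1 / (real (degree G u) * real (degree G v)))"
proof -
  have edges: "uedges G = (\<lambda>(u, v). {u, v}) ` A"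
    unfolding uedges_def assms(1) by (auto simp: image_iff insert_commute)
  have inj: "inj_on (\<lambda>(u, v). {u, v}) A"
    using assms(2) by (auto simp: inj_on_def doubleton_eq_iff)
  have "1 / (\<Prod>x\<in>{u, v}. real (degree G x)) = 1 / (real (degree G u) * real (degree G v))"
    if "(u, v) \<in> A" for u v
    using prod_degree_edge[of u v] that assms(1) by simp
  then show ?thesis
    unfolding modified_zagreb2_def edges sum.reindex[OF inj] by (intro sum.cong) auto
qed

text \<open>Since \<open>1 / 0 = 0\<close>, bounding \<open>1 / (d u * d v)\<close> from below by
  enlarging the degrees requires that they are nonzero.\<close>

lemma (in pair_graph) degree_pos:
  assumes "(u, v) \<in> parcs G"
  shows "0 < degree G u"
proof -
  have "finite {w. (u, w) \<in> parcs G}"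
    by (rule finite_subset[of _ "snd ` parcs G"]) force+
  with assms show ?thesis by (auto simp: degree_eq_card_neighbours card_gt_0_iff)
qed

fun T1_max_degree :: "vertex \<Rightarrow> nat" where
  "T1_max_degree (U i) = 1"
| "T1_max_degree (V i) = 2"
| "T1_max_degree (W i) = 4"
| "T1_max_degree (X i) = 2"
| "T1_max_degree (Y i) = 1"

lemma degree_T1_le: "degree (T1 k) a \<le> T1_max_degree a"
proof -
  interpret pair_graph "T1 k" by (rule pair_graph_T1)
  \<comment> \<open>Candidate neighbours regardless of the range of the index: \<open>W 0\<close>
    and \<open>W (k + 1)\<close> are not vertices, but an inclusion suffices for an upper bound.
    With a list, repeated entries do no harm.\<close>
  define N where "N = (case a of
      U i \<Rightarrow> [V i] | V i \<Rightarrow> [U i, W i] | W i \<Rightarrow> [V i, X i, W (i - 1), W (i + 1)]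
    | X i \<Rightarrow> [W i, Y i] | Y i \<Rightarrow> [X i])"
  have "{b. (a, b) \<in> parcs (T1 k)} \<subseteq> set N"
    by (cases a) (auto simp: N_def T1_sel T1_edges_def)
  then have "degree (T1 k) a \<le> card (set N)"
    unfolding degree_eq_card_neighbours by (intro card_mono) auto
  also have "\<dots> \<le> length N" by (rule card_length)
  also have "\<dots> = T1_max_degree a" by (cases a) (auto simp: N_def)
  finally show ?thesis .
qed

lemma sum_T1_edges:
  fixes f :: "vertex \<times> vertex \<Rightarrow> real"
  shows "sum f (T1_edges k) =
    (\<Sum>i\<in>{1..k}. f (U i, V i) + f (V i, W i) + f (W i, X i) + f (X i, Y i))
    + (\<Sum>i\<in>{1..<k}. f (W i, W (i + 1)))"
proof -
  let ?B = "\<lambda>i. {(U i, V i), (V i, W i), (W i, X i), (X i, Y i)}"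
  let ?P = "(\<lambda>i. (W i, W (i + 1))) ` {1..<k}"
  have "T1_edges k = (\<Union>i\<in>{1..k}. ?B i) \<union> ?P"
    unfolding T1_edges_def by auto
  moreover have "sum f ((\<Union>i\<in>{1..k}. ?B i) \<union> ?P) = sum f (\<Union>i\<in>{1..k}. ?B i) + sum f ?P"
    by (rule sum.union_disjoint) auto
  moreover have "sum f (\<Union>i\<in>{1..k}. ?B i) = (\<Sum>i\<in>{1..k}. sum f (?B i))"
    by (rule sum.UNION_disjoint) auto
  moreover have "sum f ?P = (\<Sum>i\<in>{1..<k}. f (W i, W (i + 1)))"
    by (subst sum.reindex) (auto simp: inj_on_def)
  ultimately show ?thesis by (simp add: add.assoc)
qed

lemma s5_T1_ge:
  assumes "1 \<le> k"
  shows "(real k - 5) / 16 \<le> s5 (T1 k)"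
proof -
  interpret pair_graph "T1 k" by (rule pair_graph_T1)
  let ?w = "\<lambda>d (u, v). 1 / (real (d u) * real (d v))"
  have "sum (?w T1_max_degree) (T1_edges k) \<le> sum (?w (degree (T1 k))) (T1_edges k)"
  proof (rule sum_mono, clarify)
    fix u v assume "(u, v) \<in> T1_edges k"
    then have "(u, v) \<in> parcs (T1 k)" "(v, u) \<in> parcs (T1 k)" by (auto simp: T1_sel)
    then have "0 < degree (T1 k) u" "0 < degree (T1 k) v" by (auto intro: degree_pos)
    then show "1 / (real (T1_max_degree u) * real (T1_max_degree v))
        \<le> 1 / (real (degree (T1 k) u) * real (degree (T1 k) v))"
      by (intro divide_left_mono mult_mono mult_pos_pos)
        (use degree_T1_le[of k u] degree_T1_le[of k v] in auto)
  qed
  also have "\<dots> = modified_zagreb2 (T1 k)"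
    by (rule modified_zagreb2_eq_sum_orientation[symmetric]) (auto simp: T1_sel T1_edges_def)
  finally have "5 / 4 * real k + real (k - 1) / 16 \<le> modified_zagreb2 (T1 k)"
    by (simp add: sum_T1_edges)
  \<comment> \<open>Subtracting \<open>(5 * k + 1) / 4\<close> leaves
    \<open>(k - 1) / 16 - 1 / 4 = (k - 5) / 16\<close>; \<open>1 \<le> k\<close> makes the truncated
    \<open>k - 1\<close> a true difference.\<close>
  with assms show ?thesis
    by (simp add: s5_def card_T1 of_nat_diff field_simps)
qed

theorem theorem1:
  shows "filterlim (\<lambda>k. s5 (T1 k)) at_top sequentially"
proof (rule filterlim_at_top_mono)
  \<comment> \<open>The bound \<open>(k - 5) / 16\<close>, split into a constant plus a positive
    multiple of \<open>k\<close>.\<close>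
  have "filterlim (\<lambda>k. -(5 / 16) + 1 / 16 * real k) at_top sequentially"
    by (intro filterlim_tendsto_add_at_top[OF tendsto_const]
        filterlim_tendsto_pos_mult_at_top[OF tendsto_const] filterlim_real_sequentially) simp
  then show "filterlim (\<lambda>k. (real k - 5) / 16) at_top sequentially"
    by (simp add: field_simps)
  show "\<forall>\<^sub>F k in sequentially. (real k - 5) / 16 \<le> s5 (T1 k)"
    using eventually_ge_at_top[of 1] by eventually_elim (rule s5_T1_ge)
qed

end
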